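(* Let $n \geq 2$ be an integer, let $S$ be a nonzero ring with only trivial idempotents and let $a,b \in S$ be $n$-potent elements. Then the following hold: (1) If $a = 0$ or $b = 0$, then $\langle a,b\rangle_n = 0$, and it is not a unit in $S$. (2) If $a = b = 1$, then $\langle a,b\rangle_n$ is a unit in $S$ if and only if $2^n - 2$ is a unit in $S$. (3) If $a = b = -1$, then: when $n$ is odd, $\langle a,b\rangle_n$ is a unit in $S$ if and only if $2 - 2^n$ is a unit in $S$; when $n$ is even, $\langle a,b\rangle_n$ is a unit in $S$ if and only if $2^n + 2$ is a unit in $S$. (4) If $a = -1$ and $b = 1$, or $a = 1$ and $b = -1$, then $\langle a,b\rangle_n = 0$, and it is not a unit in $S$. (5) If $a$ and $b$ are units in $S$ with $a \notin \{1,-1\}$ and $b \notin \{1,-1\}$, then $\langle a,b\rangle_n$ is a unit in $S$ if and only if $a+b$ and $1 + \langle a,b\rangle_{n-1}$ are both units in $S$.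
   Context: Rings are associative with unity, not necessarily commutative. A ring has only trivial idempotents if its only idempotents are $0$ and $1$. An element $x$ of a ring is $n$-potent if $x^n = x$. For elements $a,b$ of a ring $S$ and a positive integer $d$, the anti-commutator of degree $d$ is $\langle a,b\rangle_d := (a+b)^d - a^d - b^d$ (so the formula gives $0$ for $d=1$). *)

theory Defs
  imports Main
begin

text \<open>
  The class \<^class>\<open>ring_1\<close> is that of associative, not necessarily commutative, rings with
  \<open>0 \<noteq> 1\<close>.  The library's notion of a unit, \<open>u dvd 1\<close>, is only adequate for commutative
  multiplication, since it asks for a right inverse only; here a two-sided inverse is needed.
\<close>

definition ring_unit :: "'a::ring_1 \<Rightarrow> bool" where
  "ring_unit u \<longleftrightarrow> (\<exists>v. u * v = 1 \<and> v * u = 1)"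

definition potent :: "nat \<Rightarrow> 'a::ring_1 \<Rightarrow> bool" where
  "potent n x \<longleftrightarrow> x ^ n = x"

text \<open>The anti-commutator of degree \<open>d\<close>; only meant for \<open>d \<ge> 1\<close>.\<close>

definition anticomm :: "'a::ring_1 \<Rightarrow> 'a \<Rightarrow> nat \<Rightarrow> 'a"  (\<open>\<langle>_,_\<rangle>\<^bsub>_\<^esub>\<close>) where
  "\<langle>a,b\<rangle>\<^bsub>d\<^esub> = (a + b) ^ d - a ^ d - b ^ d"

end

theory Submission
  imports Defs
begin

text \<open>
  Potency of \<open>a\<close> and \<open>b\<close> turns the anti-commutator of degree \<open>n\<close> into \<open>(a + b)\<^sup>n - (a + b)\<close>,
  a polynomial in the single element \<open>a + b\<close>, even when \<open>a\<close> and \<open>b\<close> do not commute.  It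
  vanishes when \<open>a\<close> or \<open>b\<close> is \<open>0\<close>, since \<open>a + b\<close> is then itself \<open>n\<close>-potent, and for
  \<open>a, b \<in> {1, -1}\<close> it can be evaluated directly; for \<open>a = b = -1\<close> it is \<open>(-2)\<^sup>n + 2\<close>,
  whence the dependence on the parity of \<open>n\<close>.

  An invertible \<open>n\<close>-potent element has \<open>(n - 1)\<close>-st power \<open>1\<close>.  So for units \<open>a\<close> and \<open>b\<close> the
  anti-commutator of degree \<open>n - 1\<close> is \<open>(a + b)\<^bsup>n - 1\<^esup> - 2\<close>, and the one of degree \<open>n\<close> factors as
  \<open>(a + b) * (1 + \<langle>a,b\<rangle>\<^bsub>n - 1\<^esub>)\<close>.  The factors are polynomials in \<open>a + b\<close>, hence commute,
  and a product of commuting elements is a unit exactly when both factors are.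
\<close>

lemma not_ring_unit_0: "\<not> ring_unit (0::'a::ring_1)"
  by (simp add: ring_unit_def)

lemma ring_unit_mult:
  fixes x y :: "'a::ring_1"
  assumes "ring_unit x" and "ring_unit y"
  shows "ring_unit (x * y)"
proof -
  obtain u v where "x * u = 1" "u * x = 1" "y * v = 1" "v * y = 1"
    using assms by (auto simp: ring_unit_def)
  then have "(x * y) * (v * u) = 1" "(v * u) * (x * y) = 1"
    by (metis mult.assoc mult_1_left)+
  then show ?thesis by (auto simp: ring_unit_def)
qed

lemma ring_unit_if_left_right_inverse:
  fixes x :: "'a::ring_1"
  assumes "x * r = 1" and "l * x = 1"
  shows "ring_unit x"
proof -
  have "l = r" by (metis assms mult.assoc mult_1_left mult_1_right)
  then show ?thesis using assms by (auto simp: ring_unit_def)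
qed

text \<open>
  An inverse \<open>w\<close> of \<open>x * y = y * x\<close> makes each factor invertible on both sides: \<open>x\<close> has the right
  inverse \<open>y * w\<close> and the left inverse \<open>w * y\<close>, and likewise for \<open>y\<close>.  Commutativity matters:
  in general, factors of a unit need only be
  invertible on one side.
\<close>

lemma ring_unit_mult_iff_commuting:
  fixes x y :: "'a::ring_1"
  assumes comm: "x * y = y * x"
  shows "ring_unit (x * y) \<longleftrightarrow> ring_unit x \<and> ring_unit y"
proof
  assume "ring_unit (x * y)"
  then obtain w where w: "x * y * w = 1" "w * (x * y) = 1"
    by (auto simp: ring_unit_def)
  have "x * (y * w) = 1" "(w * y) * x = 1" "y * (x * w) = 1" "(w * x) * y = 1"
    using w comm by (simp_all add: mult.assoc[symmetric]) (simp_all add: mult.assoc)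
  then show "ring_unit x \<and> ring_unit y"
    by (blast intro: ring_unit_if_left_right_inverse)
qed (blast intro: ring_unit_mult)

lemma potent_unit_power_eq_1:
  fixes x :: "'a::ring_1"
  assumes "n \<ge> 1" and "potent n x" and "ring_unit x"
  shows "x ^ (n - 1) = 1"
proof -
  obtain v where v: "v * x = 1" using assms(3) by (auto simp: ring_unit_def)
  have "x * x ^ (n - 1) = x"
    using assms(1,2) by (metis One_nat_def Suc_pred less_eq_Suc_le potent_def power_Suc)
  then show ?thesis by (metis v mult.assoc mult_1_left)
qed

lemma anticomm_potent:
  assumes "potent n a" and "potent n b"
  shows "\<langle>a,b\<rangle>\<^bsub>n\<^esub> = (a + b) ^ n - (a + b)"
  using assms by (simp add: anticomm_def potent_def)

lemma anticomm_potent_units_factor: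
  fixes a b :: "'a::ring_1"
  assumes n: "n \<ge> 1"
    and a: "potent n a" "ring_unit a" and b: "potent n b" "ring_unit b"
  defines "s \<equiv> a + b" and "t \<equiv> 1 + \<langle>a,b\<rangle>\<^bsub>n - 1\<^esub>"
  shows "\<langle>a,b\<rangle>\<^bsub>n\<^esub> = s * t" and "s * t = t * s"
proof -
  have t: "t = s ^ (n - 1) - 1"
    using potent_unit_power_eq_1[OF n a] potent_unit_power_eq_1[OF n b]
    by (simp add: t_def s_def anticomm_def)
  have "s * s ^ (n - 1) = s ^ n"
    using n by (metis One_nat_def Suc_pred less_eq_Suc_le power_Suc)
  then show "\<langle>a,b\<rangle>\<^bsub>n\<^esub> = s * t"
    using anticomm_potent[OF a(1) b(1)] by (simp add: t s_def right_diff_distrib)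
  show "s * t = t * s"
    by (simp add: t algebra_simps power_commutes)
qed

theorem theorem2p16:
  fixes a b :: "'a::ring_1" and n :: nat
  assumes "n \<ge> 2"
    and "{e::'a. e * e = e} = {0, 1}"
    and "potent n a" and "potent n b"
  shows "(a = 0 \<or> b = 0 \<longrightarrow> \<langle>a,b\<rangle>\<^bsub>n\<^esub> = 0 \<and> \<not> ring_unit \<langle>a,b\<rangle>\<^bsub>n\<^esub>)
    \<and> (a = 1 \<and> b = 1 \<longrightarrow> (ring_unit \<langle>a,b\<rangle>\<^bsub>n\<^esub> \<longleftrightarrow> ring_unit (2 ^ n - 2 :: 'a)))
    \<and> (a = - 1 \<and> b = - 1 \<longrightarrow>
         (odd n \<longrightarrow> (ring_unit \<langle>a,b\<rangle>\<^bsub>n\<^esub> \<longleftrightarrow> ring_unit (2 - 2 ^ n :: 'a))) \<and>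
         (even n \<longrightarrow> (ring_unit \<langle>a,b\<rangle>\<^bsub>n\<^esub> \<longleftrightarrow> ring_unit (2 ^ n + 2 :: 'a))))
    \<and> ((a = - 1 \<and> b = 1) \<or> (a = 1 \<and> b = - 1) \<longrightarrow>
         \<langle>a,b\<rangle>\<^bsub>n\<^esub> = 0 \<and> \<not> ring_unit \<langle>a,b\<rangle>\<^bsub>n\<^esub>)
    \<and> (ring_unit a \<and> ring_unit b \<and> a \<notin> {1, - 1} \<and> b \<notin> {1, - 1} \<longrightarrow>
         (ring_unit \<langle>a,b\<rangle>\<^bsub>n\<^esub> \<longleftrightarrow>
            ring_unit (a + b) \<and> ring_unit (1 + \<langle>a,b\<rangle>\<^bsub>n - 1\<^esub>)))"
proof (intro conjI impI)
  have pow: "a ^ n = a" "b ^ n = b" using assms(3,4) by (simp_all add: potent_def)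
  have np: "0 < n" using assms(1) by simp
  note ac = anticomm_potent[OF assms(3,4)]
  {
    assume "a = 0 \<or> b = 0"
    then show "\<langle>a,b\<rangle>\<^bsub>n\<^esub> = 0" unfolding ac using pow by auto
    then show "\<not> ring_unit \<langle>a,b\<rangle>\<^bsub>n\<^esub>" by (simp add: not_ring_unit_0)
  next
    assume "a = 1 \<and> b = 1"
    then show "ring_unit \<langle>a,b\<rangle>\<^bsub>n\<^esub> \<longleftrightarrow> ring_unit (2 ^ n - 2 :: 'a)"
      unfolding ac by simp
  next
    assume "a = - 1 \<and> b = - 1"
    then have eq: "\<langle>a,b\<rangle>\<^bsub>n\<^esub> = (- 2) ^ n + 2" unfolding ac by simp
    show "ring_unit \<langle>a,b\<rangle>\<^bsub>n\<^esub> \<longleftrightarrow> ring_unit (2 - 2 ^ n :: 'a)" if "odd n"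
      using that by (simp add: eq)
    show "ring_unit \<langle>a,b\<rangle>\<^bsub>n\<^esub> \<longleftrightarrow> ring_unit (2 ^ n + 2 :: 'a)" if "even n"
      using that by (simp add: eq)
  next
    assume "(a = - 1 \<and> b = 1) \<or> (a = 1 \<and> b = - 1)"
    then have "a + b = 0" by auto
    then show "\<langle>a,b\<rangle>\<^bsub>n\<^esub> = 0" unfolding ac using np by (simp add: zero_power)
    then show "\<not> ring_unit \<langle>a,b\<rangle>\<^bsub>n\<^esub>" by (simp add: not_ring_unit_0)
  next
    assume "ring_unit a \<and> ring_unit b \<and> a \<notin> {1, - 1} \<and> b \<notin> {1, - 1}"
    then have u: "ring_unit a" "ring_unit b" by simp_all
    have "n \<ge> 1" using np by simp
    note factor = anticomm_potent_units_factor[OF this assms(3) u(1) assms(4) u(2)]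
    show "ring_unit \<langle>a,b\<rangle>\<^bsub>n\<^esub> \<longleftrightarrow>
        ring_unit (a + b) \<and> ring_unit (1 + \<langle>a,b\<rangle>\<^bsub>n - 1\<^esub>)"
      unfolding factor(1) by (rule ring_unit_mult_iff_commuting[OF factor(2)])
  }
qed

end
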